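(* Let $\mathcal S$ be the class of Schreier split epimorphisms in $\mathbf{RPOGrp}$. The category $\mathbf{RPOGrp}$ satisfies the $\mathcal S$-Smith-is-Huq property: two $\mathcal S$-effective equivalence relations $R,S$ over the same right-preordered group $X$ centralize each other in the sense of Smith if and only if their normalizations commute in the sense of Huq.
   Context: Groups are written additively and need not be abelian. A right-preordered group is a pair $(G,P_G)$ with $G$ a group and $P_G$ a submonoid of $G$ (the positive cone). Morphisms $(G,P_G)\to(H,P_H)$ in $\mathbf{RPOGrp}$ are group homomorphisms $f$ with $f(P_G)\subseteq P_H$. Limits are computed separately on groups and on positive cones. A split epimorphism $d:(X_1,P_1)\to(X_0,P_0)$ with section $e$ in $\mathbf{RPOGrp}$ is Schreier if $a-e(d(a))\in P_1$ for all $a\in P_1$. An effective equivalence relation $R$ over $X$ is the kernel pair of a morphism with domain $X$, with projections $p_0^R,p_1^R:R\to X$ and diagonal $\Delta_R:X\to R$. It is $\mathcal S$-effective if both split epimorphisms $(p_0^R,\Delta_R)$ and $(p_1^R,\Delta_R)$ are Schreier. Two equivalence relations $R,S$ over $X$ centralize each other in the sense of Smith if, on the pullback $R\times_XS$ of $p_1^R$ and $p_0^S$ (triples $(x,y,z)$ with $(x,y)\in R$, $(y,z)\in S$, with the pullback positive cone), there is a morphism $p:R\times_XS\to X$ in $\mathbf{RPOGrp}$ with $p(x,y,y)=x$ for all $(x,y)\in R$ and $p(y,y,z)=z$ for all $(y,z)\in S$. The normalization of an equivalence relation $R$ over $X$ is the subobject $N$ of $X$ obtained as the pullback of $R\rightarrowtail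 X\times X$ along $(0,\mathrm{id}_X):X\to X\times X$. Two subobjects $x:A\rightarrowtail X$ and $y:B\rightarrowtail X$ commute in the sense of Huq if there is a morphism $\varphi:A\times B\to X$ with $\varphi(a,0)=x(a)$ and $\varphi(0,b)=y(b)$ for all $a\in A$, $b\in B$. *)

theory Defs
  imports "HOL-Algebra.Group"
begin

text \<open>
  HOL-Algebra writes groups multiplicatively: \<open>x + y\<close>, \<open>0\<close> and \<open>a - b\<close> of the additive
  notation for (not necessarily abelian) groups become \<open>x \<otimes> y\<close>, \<open>\<one>\<close> and \<open>a \<otimes> inv b\<close>.
\<close>

type_synonym 'a rpogrp = "'a monoid \<times> 'a set"

abbreviation grp :: "'a rpogrp \<Rightarrow> 'a monoid" where "grp \<equiv> fst"

abbreviation cone :: "'a rpogrp \<Rightarrow> 'a set" where "cone \<equiv> snd"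

definition rpo_group :: "'a rpogrp \<Rightarrow> bool" where
  "rpo_group X \<longleftrightarrow> group (grp X) \<and> submonoid (cone X) (grp X)"

definition rpo_hom :: "'a rpogrp \<Rightarrow> 'b rpogrp \<Rightarrow> ('a \<Rightarrow> 'b) set" where
  "rpo_hom X Y = {f \<in> hom (grp X) (grp Y). f ` cone X \<subseteq> cone Y}"

definition rpo_prod :: "'a rpogrp \<Rightarrow> 'b rpogrp \<Rightarrow> ('a \<times> 'b) rpogrp" where
  "rpo_prod A B = (grp A \<times>\<times> grp B, cone A \<times> cone B)"

text \<open>The pullback of \<open>f : A \<rightarrow> C\<close> and \<open>g : B \<rightarrow> C\<close>, with projections \<open>fst\<close> and \<open>snd\<close>.\<close>

definition rpo_pullback ::
    "'a rpogrp \<Rightarrow> ('a \<Rightarrow> 'c) \<Rightarrow> 'b rpogrp \<Rightarrow> ('b \<Rightarrow> 'c) \<Rightarrow> ('a \<times> 'b) rpogrp" where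
  "rpo_pullback A f B g =
    ((grp A \<times>\<times> grp B)\<lparr>carrier := {(a, b) \<in> carrier (grp A) \<times> carrier (grp B). f a = g b}\<rparr>,
     {(a, b) \<in> cone A \<times> cone B. f a = g b})"

definition schreier_split_epi ::
    "'a rpogrp \<Rightarrow> 'b rpogrp \<Rightarrow> ('a \<Rightarrow> 'b) \<Rightarrow> ('b \<Rightarrow> 'a) \<Rightarrow> bool" where
  "schreier_split_epi X1 X0 d e \<longleftrightarrow>
    d \<in> rpo_hom X1 X0 \<and> e \<in> rpo_hom X0 X1 \<and> (\<forall>x \<in> carrier (grp X0). d (e x) = x) \<and>
    (\<forall>a \<in> cone X1. a \<otimes>\<^bsub>grp X1\<^esub> inv\<^bsub>grp X1\<^esub> (e (d a)) \<in> cone X1)"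

text \<open>
  Relations over \<open>X\<close> are objects \<open>R\<close> whose underlying group consists of pairs of elements of \<open>X\<close>;
  the projections are \<open>fst\<close> and \<open>snd\<close>, and the inclusion into \<open>X \<times> X\<close> is the identity map.
  HOL cannot quantify existentially over the type of the codomain \<open>Y\<close> inside a definition,
  so the morphism \<open>f : X \<rightarrow> Y\<close> of which \<open>R\<close> is the kernel pair is a parameter here.
\<close>

definition effective_eqrel ::
    "'a rpogrp \<Rightarrow> 'b rpogrp \<Rightarrow> ('a \<Rightarrow> 'b) \<Rightarrow> ('a \<times> 'a) rpogrp \<Rightarrow> bool" where
  "effective_eqrel X Y f R \<longleftrightarrow> rpo_group Y \<and> f \<in> rpo_hom X Y \<and> R = rpo_pullback X f X f"

definition S_effective_eqrel ::
    "'a rpogrp \<Rightarrow> 'b rpogrp \<Rightarrow> ('a \<Rightarrow> 'b) \<Rightarrow> ('a \<times> 'a) rpogrp \<Rightarrow> bool" where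
  "S_effective_eqrel X Y f R \<longleftrightarrow> effective_eqrel X Y f R \<and>
    schreier_split_epi R X fst (\<lambda>x. (x, x)) \<and> schreier_split_epi R X snd (\<lambda>x. (x, x))"

text \<open>A triple \<open>(x, y, z)\<close> in the pullback of \<open>R\<close> and \<open>S\<close> over \<open>X\<close> is the pair \<open>((x, y), (y, z))\<close>.\<close>

definition smith_centralize ::
    "'a rpogrp \<Rightarrow> ('a \<times> 'a) rpogrp \<Rightarrow> ('a \<times> 'a) rpogrp \<Rightarrow> bool" where
  "smith_centralize X R S \<longleftrightarrow>
    (\<exists>p \<in> rpo_hom (rpo_pullback R snd S fst) X.
      (\<forall>(x, y) \<in> carrier (grp R). p ((x, y), (y, y)) = x) \<and>
      (\<forall>(y, z) \<in> carrier (grp S). p ((y, y), (y, z)) = z))"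

text \<open>
  The pullback of \<open>(0, id) : X \<rightarrow> X \<times> X\<close> and \<open>R \<rightarrow> X \<times> X\<close>, with elements \<open>(n, (0, n))\<close>;
  it is a subobject of \<open>X\<close> through its first projection \<open>fst\<close>.
\<close>

definition normalization :: "'a rpogrp \<Rightarrow> ('a \<times> 'a) rpogrp \<Rightarrow> ('a \<times> 'a \<times> 'a) rpogrp" where
  "normalization X R = rpo_pullback X (\<lambda>x. (\<one>\<^bsub>grp X\<^esub>, x)) R id"

definition huq_commute ::
    "'x rpogrp \<Rightarrow> 'a rpogrp \<Rightarrow> ('a \<Rightarrow> 'x) \<Rightarrow> 'b rpogrp \<Rightarrow> ('b \<Rightarrow> 'x) \<Rightarrow> bool" where
  "huq_commute X A x B y \<longleftrightarrow>
    (\<exists>\<phi> \<in> rpo_hom (rpo_prod A B) X.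
      (\<forall>a \<in> carrier (grp A). \<phi> (a, \<one>\<^bsub>grp B\<^esub>) = x a) \<and>
      (\<forall>b \<in> carrier (grp B). \<phi> (\<one>\<^bsub>grp A\<^esub>, b) = y b))"

end

theory Submission
  imports Defs
begin

text \<open>
  The normalizations of \<open>R\<close> and \<open>S\<close> are \<open>ker f\<close> and \<open>ker g\<close> with the induced cones.  A Smith
  connector \<open>p\<close> restricts to \<open>\<phi>(a, b) = p(a, 0, b)\<close>.  Conversely, a Huq commutator only says that
  \<open>ker f\<close> and \<open>ker g\<close> commute elementwise, and then \<open>p(x, y, z) = x - y + z\<close> is a group
  homomorphism; it is positive because the Schreier condition for the second projection of \<open>R\<close>
  makes \<open>x - y\<close> positive whenever \<open>(x, y)\<close> is.
\<close>

lemma rpo_pullback_simps [simp]: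
  "carrier (grp (rpo_pullback A f B g)) = {(a, b) \<in> carrier (grp A) \<times> carrier (grp B). f a = g b}"
  "cone (rpo_pullback A f B g) = {(a, b) \<in> cone A \<times> cone B. f a = g b}"
  "(a, b) \<otimes>\<^bsub>grp (rpo_pullback A f B g)\<^esub> (a', b') = (a \<otimes>\<^bsub>grp A\<^esub> a', b \<otimes>\<^bsub>grp B\<^esub> b')"
  "\<one>\<^bsub>grp (rpo_pullback A f B g)\<^esub> = (\<one>\<^bsub>grp A\<^esub>, \<one>\<^bsub>grp B\<^esub>)"
  by (auto simp: rpo_pullback_def DirProd_def)

lemma rpo_prod_simps [simp]:
  "carrier (grp (rpo_prod A B)) = carrier (grp A) \<times> carrier (grp B)"
  "cone (rpo_prod A B) = cone A \<times> cone B"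
  "(a, b) \<otimes>\<^bsub>grp (rpo_prod A B)\<^esub> (a', b') = (a \<otimes>\<^bsub>grp A\<^esub> a', b \<otimes>\<^bsub>grp B\<^esub> b')"
  by (auto simp: rpo_prod_def DirProd_def)

text \<open>Both \<open>(y, y)\<close> and \<open>(inv y, inv y)\<close> satisfy the pullback
  condition whatever \<open>f\<close> is, and a one-sided inverse is unique in each coordinate. So
  the definite description in \<open>m_inv\<close> can be evaluated directly, without a group
  structure on the pullback.\<close>

lemma inv_kernel_pair_diagonal:
  assumes "group (grp X)" and y: "y \<in> carrier (grp X)"
  shows "inv\<^bsub>grp (rpo_pullback X f X f)\<^esub> (y, y) = (inv\<^bsub>grp X\<^esub> y, inv\<^bsub>grp X\<^esub> y)"
proof -
  interpret group "grp X" by fact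
  show ?thesis
    unfolding m_inv_def[of "grp (rpo_pullback X f X f)"]
    by (rule the_equality) (use y in \<open>auto dest: inv_equality\<close>)
qed

text \<open>The Schreier condition for \<open>snd\<close> subtracts the diagonal pair of the second
  entry: (x, y) - (y, y) = (x - y, 0) is positive in \<open>R\<close>, hence its first entry is
  positive in \<open>X\<close>.\<close>

lemma S_effective_eqrel_diff_in_cone:
  assumes X: "rpo_group X" and R: "S_effective_eqrel X Y f R" and xy: "(x, y) \<in> cone R"
  shows "x \<otimes>\<^bsub>grp X\<^esub> inv\<^bsub>grp X\<^esub> y \<in> cone X"
proof -
  have grp: "group (grp X)" and sub: "cone X \<subseteq> carrier (grp X)"
    using X by (auto simp: rpo_group_def submonoid_def)
  have R_eq: "R = rpo_pullback X f X f"
    and sch: "\<forall>a \<in> cone R. a \<otimes>\<^bsub>grp R\<^esub> inv\<^bsub>grp R\<^esub> (snd a, snd a) \<in> cone R"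
    using R unfolding S_effective_eqrel_def effective_eqrel_def schreier_split_epi_def by blast+
  have "y \<in> carrier (grp X)" using xy sub by (auto simp: R_eq)
  then show ?thesis
    using bspec[OF sch xy] by (simp add: R_eq inv_kernel_pair_diagonal[OF grp])
qed

lemma smith_centralize_imp_huq_commute:
  assumes X: "rpo_group X"
    and R: "R = rpo_pullback X f X f"
    and S: "S = rpo_pullback X g X g"
    and smith: "smith_centralize X R S"
  shows "huq_commute X (normalization X R) fst (normalization X S) fst"
proof -
  interpret group "grp X" using X by (simp add: rpo_group_def)
  have one_cone: "\<one>\<^bsub>grp X\<^esub> \<in> cone X" using X by (simp add: rpo_group_def submonoid_def)
  obtain p where p: "p \<in> rpo_hom (rpo_pullback R snd S fst) X"
    and pR: "\<forall>(x, y) \<in> carrier (grp R). p ((x, y), (y, y)) = x"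
    and pS: "\<forall>(y, z) \<in> carrier (grp S). p ((y, y), (y, z)) = z"
    using smith by (auto simp: smith_centralize_def)
  \<comment> \<open>An element of the normalization provides (0, a) in \<open>R\<close>. The
    connector needs (a, 0), which is also in \<open>R\<close> since the kernel-pair condition is
    symmetric.\<close>
  define \<phi> :: "('a \<times> 'a \<times> 'a) \<times> ('a \<times> 'a \<times> 'a) \<Rightarrow> 'a"
    where "\<phi> = (\<lambda>(a, b). p ((fst a, \<one>\<^bsub>grp X\<^esub>), (\<one>\<^bsub>grp X\<^esub>, fst b)))"
  have p_mult: "p (u \<otimes>\<^bsub>grp (rpo_pullback R snd S fst)\<^esub> v) = p u \<otimes>\<^bsub>grp X\<^esub> p v"
    if "u \<in> carrier (grp (rpo_pullback R snd S fst))" "v \<in> carrier (grp (rpo_pullback R snd S fst))"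
    for u v
    using p that unfolding rpo_hom_def hom_def by blast
  have p_closed: "p u \<in> carrier (grp X)" if "u \<in> carrier (grp (rpo_pullback R snd S fst))" for u
    using p that unfolding rpo_hom_def hom_def by blast
  have p_cone: "p u \<in> cone X" if "u \<in> cone (rpo_pullback R snd S fst)" for u
    using p that unfolding rpo_hom_def by blast
  have "\<phi> \<in> rpo_hom (rpo_prod (normalization X R) (normalization X S)) X"
    unfolding rpo_hom_def hom_def
  proof (intro CollectI conjI ballI image_subsetI funcsetI)
    fix u assume "u \<in> carrier (grp (rpo_prod (normalization X R) (normalization X S)))"
    then show "\<phi> u \<in> carrier (grp X)"
      by (auto simp: \<phi>_def normalization_def R S intro!: p_closed)
  next
    fix u v
    assume "u \<in> carrier (grp (rpo_prod (normalization X R) (normalization X S)))"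
      and "v \<in> carrier (grp (rpo_prod (normalization X R) (normalization X S)))"
    then obtain a b a' b' where uv: "u = ((a, (\<one>\<^bsub>grp X\<^esub>, a)), (b, (\<one>\<^bsub>grp X\<^esub>, b)))"
      "v = ((a', (\<one>\<^bsub>grp X\<^esub>, a')), (b', (\<one>\<^bsub>grp X\<^esub>, b')))"
      and mem: "a \<in> carrier (grp X)" "a' \<in> carrier (grp X)"
        "b \<in> carrier (grp X)" "b' \<in> carrier (grp X)"
      and ker: "f a = f \<one>\<^bsub>grp X\<^esub>" "f a' = f \<one>\<^bsub>grp X\<^esub>" "g b = g \<one>\<^bsub>grp X\<^esub>" "g b' = g \<one>\<^bsub>grp X\<^esub>"
      by (auto simp: normalization_def R S)
    \<comment> \<open>Triples with middle entry 0 are closed under the operation, so the additivity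
      of \<open>p\<close> restricts to them.\<close>
    show "\<phi> (u \<otimes>\<^bsub>grp (rpo_prod (normalization X R) (normalization X S))\<^esub> v) = \<phi> u \<otimes>\<^bsub>grp X\<^esub> \<phi> v"
      using p_mult[of "((a, \<one>\<^bsub>grp X\<^esub>), (\<one>\<^bsub>grp X\<^esub>, b))" "((a', \<one>\<^bsub>grp X\<^esub>), (\<one>\<^bsub>grp X\<^esub>, b'))"] mem ker
      by (simp add: uv \<phi>_def normalization_def R S)
  next
    fix u assume "u \<in> cone (rpo_prod (normalization X R) (normalization X S))"
    \<comment> \<open>The inserted middle entry 0 is positive because the cone is a
      submonoid.\<close>
    then show "\<phi> u \<in> cone X"
      using one_cone by (auto simp: \<phi>_def normalization_def R S intro!: p_cone)
  qed
  \<comment> \<open>The two Huq identities are the Smith identities at y = 0: p(a, 0, 0) = a and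
    p(0, 0, b) = b.\<close>
  moreover have "\<phi> (a, \<one>\<^bsub>grp (normalization X S)\<^esub>) = fst a"
    if "a \<in> carrier (grp (normalization X R))" for a
    using that pR by (auto simp: \<phi>_def normalization_def R)
  moreover have "\<phi> (\<one>\<^bsub>grp (normalization X R)\<^esub>, b) = fst b"
    if "b \<in> carrier (grp (normalization X S))" for b
    using that pS by (auto simp: \<phi>_def normalization_def S)
  ultimately show ?thesis
    unfolding huq_commute_def by blast
qed

text \<open>In the product, (a, 0) and (0, b) commute, both sums being (a, b). The homomorphism
  \<open>\<phi>\<close> sends them to a and b, so these commute in \<open>X\<close>.\<close>

lemma huq_commute_imp_kernels_commute:
  assumes X: "rpo_group X"
    and R: "R = rpo_pullback X f X f" and S: "S = rpo_pullback X g X g"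
    and huq: "huq_commute X (normalization X R) fst (normalization X S) fst"
    and a: "a \<in> carrier (grp X)" "f a = f \<one>\<^bsub>grp X\<^esub>"
    and b: "b \<in> carrier (grp X)" "g b = g \<one>\<^bsub>grp X\<^esub>"
  shows "a \<otimes>\<^bsub>grp X\<^esub> b = b \<otimes>\<^bsub>grp X\<^esub> a"
proof -
  interpret group "grp X" using X by (simp add: rpo_group_def)
  let ?NR = "normalization X R" and ?NS = "normalization X S"
  \<comment> \<open>Elements of the normalizations carry their witness pair, so a, b and 0 appear as
    \<open>?a\<close>, \<open>?b\<close> and \<open>?o\<close>.\<close>
  let ?a = "(a, (\<one>\<^bsub>grp X\<^esub>, a))" and ?b = "(b, (\<one>\<^bsub>grp X\<^esub>, b))"
    and ?o = "(\<one>\<^bsub>grp X\<^esub>, (\<one>\<^bsub>grp X\<^esub>, \<one>\<^bsub>grp X\<^esub>))"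
  obtain \<phi> where \<phi>: "\<phi> \<in> rpo_hom (rpo_prod ?NR ?NS) X"
    and \<phi>1: "\<forall>a \<in> carrier (grp ?NR). \<phi> (a, \<one>\<^bsub>grp ?NS\<^esub>) = fst a"
    and \<phi>2: "\<forall>b \<in> carrier (grp ?NS). \<phi> (\<one>\<^bsub>grp ?NR\<^esub>, b) = fst b"
    using huq by (auto simp: huq_commute_def)
  have a_mem: "?a \<in> carrier (grp ?NR)" "?o \<in> carrier (grp ?NR)"
    and b_mem: "?b \<in> carrier (grp ?NS)" "?o \<in> carrier (grp ?NS)"
    using a b by (auto simp: normalization_def R S)
  have one: "\<one>\<^bsub>grp ?NR\<^esub> = ?o" "\<one>\<^bsub>grp ?NS\<^esub> = ?o"
    by (simp_all add: normalization_def R S)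
  have \<phi>a: "\<phi> (?a, ?o) = a" and \<phi>b: "\<phi> (?o, ?b) = b"
    using bspec[OF \<phi>1 a_mem(1)] bspec[OF \<phi>2 b_mem(1)] by (simp_all add: one)
  have mult: "\<phi> (u \<otimes>\<^bsub>grp (rpo_prod ?NR ?NS)\<^esub> v) = \<phi> u \<otimes>\<^bsub>grp X\<^esub> \<phi> v"
    if "u \<in> carrier (grp ?NR) \<times> carrier (grp ?NS)"
      and "v \<in> carrier (grp ?NR) \<times> carrier (grp ?NS)" for u v
    using \<phi> that by (auto simp: rpo_hom_def hom_def)
  have "(?a, ?o) \<otimes>\<^bsub>grp (rpo_prod ?NR ?NS)\<^esub> (?o, ?b) = (?a, ?b)"
    and "(?o, ?b) \<otimes>\<^bsub>grp (rpo_prod ?NR ?NS)\<^esub> (?a, ?o) = (?a, ?b)"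
    using a b by (simp_all add: normalization_def R S)
  then show ?thesis
    using mult[of "(?a, ?o)" "(?o, ?b)"] mult[of "(?o, ?b)" "(?a, ?o)"] a_mem b_mem \<phi>a \<phi>b
    by simp
qed

text \<open>Supplies the kernel elements to be interchanged in the converse direction: x - y is used
  for \<open>R\<close> and - x + y for \<open>S\<close>. The kernel is written as a fibre over the
  image of 0 to match the pullback condition.\<close>

lemma rpo_hom_eq_imp_diff_in_kernel:
  assumes X: "rpo_group X" and Y: "rpo_group Y" and f: "f \<in> rpo_hom X Y"
    and xy: "x \<in> carrier (grp X)" "y \<in> carrier (grp X)" "f x = f y"
  shows "f (x \<otimes>\<^bsub>grp X\<^esub> inv\<^bsub>grp X\<^esub> y) = f \<one>\<^bsub>grp X\<^esub>"
    and "f (inv\<^bsub>grp X\<^esub> x \<otimes>\<^bsub>grp X\<^esub> y) = f \<one>\<^bsub>grp X\<^esub>"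
proof -
  interpret group_hom "grp X" "grp Y" f
    using X Y f by (simp add: rpo_group_def rpo_hom_def group_hom_def group_hom_axioms_def)
  show "f (x \<otimes>\<^bsub>grp X\<^esub> inv\<^bsub>grp X\<^esub> y) = f \<one>\<^bsub>grp X\<^esub>"
    and "f (inv\<^bsub>grp X\<^esub> x \<otimes>\<^bsub>grp X\<^esub> y) = f \<one>\<^bsub>grp X\<^esub>"
    using xy by simp_all
qed

text \<open>Commuting kernels make x - y + z additive. Read as (x - y) + z, it is positive as a sum
  of two positive elements, the first by the Schreier condition on \<open>R\<close>.\<close>

lemma huq_commute_imp_smith_centralize:
  assumes X: "rpo_group X"
    and SR: "S_effective_eqrel X Y f R"
    and Z: "rpo_group Z" and g: "g \<in> rpo_hom X Z" and S: "S = rpo_pullback X g X g"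
    and huq: "huq_commute X (normalization X R) fst (normalization X S) fst"
  shows "smith_centralize X R S"
proof -
  interpret group "grp X" using X by (simp add: rpo_group_def)
  have Y: "rpo_group Y" and f: "f \<in> rpo_hom X Y" and R: "R = rpo_pullback X f X f"
    using SR by (simp_all add: S_effective_eqrel_def effective_eqrel_def)
  have cone_mult: "\<And>x y. \<lbrakk>x \<in> cone X; y \<in> cone X\<rbrakk> \<Longrightarrow> x \<otimes>\<^bsub>grp X\<^esub> y \<in> cone X"
    using X by (simp add: rpo_group_def submonoid_def)
  \<comment> \<open>This is the Mal'tsev operation of a group. The ignored component is the second
    copy of y, equal to the first on the pullback.\<close>
  define p :: "('a \<times> 'a) \<times> ('a \<times> 'a) \<Rightarrow> 'a"
    where "p = (\<lambda>((x, y), (_, z)). x \<otimes>\<^bsub>grp X\<^esub> inv\<^bsub>grp X\<^esub> y \<otimes>\<^bsub>grp X\<^esub> z)"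
  have "p \<in> rpo_hom (rpo_pullback R snd S fst) X"
    unfolding rpo_hom_def hom_def
  proof (intro CollectI conjI ballI image_subsetI funcsetI)
    fix u assume "u \<in> carrier (grp (rpo_pullback R snd S fst))"
    then show "p u \<in> carrier (grp X)" by (auto simp: p_def R S)
  next
    fix u v
    assume "u \<in> carrier (grp (rpo_pullback R snd S fst))"
      and "v \<in> carrier (grp (rpo_pullback R snd S fst))"
    then obtain x y z x' y' z' where uv: "u = ((x, y), (y, z))" "v = ((x', y'), (y', z'))"
      and mem: "x \<in> carrier (grp X)" "y \<in> carrier (grp X)" "z \<in> carrier (grp X)"
        "x' \<in> carrier (grp X)" "y' \<in> carrier (grp X)" "z' \<in> carrier (grp X)"
      and eq: "f x' = f y'" "g y = g z"
      by (auto simp: R S)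
    \<comment> \<open>Expanding gives p(u + v) = x + (k + l) + z' and p(u) + p(v) = x + (l + k) +
      z'. Since k lies in the kernel of \<open>f\<close> and l in that of \<open>g\<close>, the two
      agree.\<close>
    let ?k = "x' \<otimes>\<^bsub>grp X\<^esub> inv\<^bsub>grp X\<^esub> y'" and ?l = "inv\<^bsub>grp X\<^esub> y \<otimes>\<^bsub>grp X\<^esub> z"
    have comm: "?k \<otimes>\<^bsub>grp X\<^esub> ?l = ?l \<otimes>\<^bsub>grp X\<^esub> ?k"
      using mem eq by (intro huq_commute_imp_kernels_commute[OF X R S huq]
          rpo_hom_eq_imp_diff_in_kernel[OF X Y f] rpo_hom_eq_imp_diff_in_kernel[OF X Z g]) auto
    have "p (u \<otimes>\<^bsub>grp (rpo_pullback R snd S fst)\<^esub> v) = x \<otimes>\<^bsub>grp X\<^esub> (?k \<otimes>\<^bsub>grp X\<^esub> ?l) \<otimes>\<^bsub>grp X\<^esub> z'"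
      using mem by (simp add: uv p_def R S inv_mult_group m_assoc)
    also have "\<dots> = p u \<otimes>\<^bsub>grp X\<^esub> p v"
      unfolding comm using mem by (simp add: uv p_def m_assoc)
    finally show "p (u \<otimes>\<^bsub>grp (rpo_pullback R snd S fst)\<^esub> v) = p u \<otimes>\<^bsub>grp X\<^esub> p v" .
  next
    fix u assume "u \<in> cone (rpo_pullback R snd S fst)"
    then obtain x y z where u: "u = ((x, y), (y, z))" and xy: "(x, y) \<in> cone R" and z: "z \<in> cone X"
      by (auto simp: S)
    show "p u \<in> cone X"
      using cone_mult[OF S_effective_eqrel_diff_in_cone[OF X SR xy] z] by (simp add: u p_def)
  qed
  moreover have "\<forall>(x, y) \<in> carrier (grp R). p ((x, y), (y, y)) = x"
    by (auto simp: p_def R m_assoc)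
  moreover have "\<forall>(y, z) \<in> carrier (grp S). p ((y, y), (y, z)) = z"
    by (auto simp: p_def S)
  ultimately show ?thesis
    unfolding smith_centralize_def by blast
qed

theorem mainTheorem17:
  fixes X :: "'a rpogrp" and Y :: "'b rpogrp" and Z :: "'c rpogrp"
    and f :: "'a \<Rightarrow> 'b" and g :: "'a \<Rightarrow> 'c"
    and R S :: "('a \<times> 'a) rpogrp"
  assumes "rpo_group X"
    and "S_effective_eqrel X Y f R"
    and "S_effective_eqrel X Z g S"
  shows "smith_centralize X R S \<longleftrightarrow>
    huq_commute X (normalization X R) fst (normalization X S) fst"
proof -
  have "R = rpo_pullback X f X f"
    and "rpo_group Z" "g \<in> rpo_hom X Z" "S = rpo_pullback X g X g"
    using assms(2,3) by (simp_all add: S_effective_eqrel_def effective_eqrel_def)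
  then show ?thesis
    using smith_centralize_imp_huq_commute[OF assms(1)]
      huq_commute_imp_smith_centralize[OF assms(1,2)] by blast
qed

end
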